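(* Let $M$ be a reduced root-closed Cale monoid with tame Cale basis $Q$. Then $$\mathrm{inCl}(M)\cong(\mathrm{Ap}(M,Q),\oplus).$$
   Context: Monoids are commutative, cancellative and written additively; $\mathbb{N}=\{0,1,2,\dots\}$. A monoid $M$ is reduced if its only unit is $0$. $\langle Q\rangle$ denotes the submonoid generated by $Q$. A reduced monoid $M$ is inside factorial with base (Cale basis) $Q$, where $Q$ is a set of nonzero elements of $M$, if (i) for each $x\in M$ there is a positive integer $n(x)$ with $n(x)x\in\langle Q\rangle$, and (ii) whenever $\sum_{q\in Q}\lambda_q q=\sum_{q\in Q}\mu_q q$ with $\lambda_q,\mu_q\in\mathbb{N}$, all but finitely many zero, then $\lambda_q=\mu_q$ for all $q\in Q$. Let $\mathrm{G}(M)$ be the quotient group of $M$. $M$ is root-closed if whenever $nz\in M$ for some positive integer $n$ and some $z\in\mathrm{G}(M)$, then $z\in M$. Write $a\le_M b$ if $a+c=b$ for some $c\in M$, and $\lambda(x,y)=\sup\{m/n \mid m\in\mathbb{N},\ n\in\mathbb{Z}^+,\ mx\le_M ny\}$. A Cale base $Q$ is tame if for every $q\in Q$ there is a positive integer $\ell(q)$ with $\ell(q)\lambda(q,x)\in\mathbb{N}$ for all $x\in M$; $\ell(q)$ is taken to be the least such integer. A Cale monoid is an inside factorial monoid with a tame base. Define the injective monoid morphism $\varphi:M\to\mathbb{N}^{(Q)}$ (finitely supported functions) by $\varphi(x)(q)=\ell(q)\lambda(q,x)$. For a cancellative monoid $S$ and a submonoid $T$, with $\mathrm{G}(T)$ the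 subgroup generated by $T$ in the quotient group of $S$, $S/T$ denotes the quotient of $S$ by the congruence $s\sim_T s'$ iff $s'-s\in\mathrm{G}(T)$. The inner class group of $M$ is $\mathrm{inCl}(M)=\varphi(M)/\varphi(F)$ with $F=\langle Q\rangle$. The Apéry set is $\mathrm{Ap}(M,Q)=M\setminus(Q+M)$. For $M$ reduced, root-closed and inside factorial with base $Q$, every element of $M$ can be written uniquely as $c+f$ with $c\in\mathrm{Ap}(M,Q)$ and $f\in\langle Q\rangle$. For $a,b\in\mathrm{Ap}(M,Q)$, $a\oplus b$ is the element $c\in\mathrm{Ap}(M,Q)$ such that $a+b\in c+\langle Q\rangle$. *)

theory Defs
  imports "HOL-Algebra.Divisibility" "HOL-Algebra.Generated_Groups"
    "HOL-Algebra.FiniteProduct"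
    "HOL-Library.Extended_Nonnegative_Real"
begin

text \<open>
  Monoids are the multiplicative records of HOL-Algebra. The additive \<open>a + b\<close> and \<open>n x\<close> are
  therefore \<open>a \<otimes>\<^bsub>M\<^esub> b\<close> and \<open>x [^]\<^bsub>M\<^esub> n\<close>, the neutral element is \<open>\<one>\<^bsub>M\<^esub>\<close>, and the order
  \<open>a \<le>\<^sub>M b\<close> is \<open>a divides\<^bsub>M\<^esub> b\<close>.
\<close>

subsection \<open>Quotients by congruences and the quotient group\<close>

definition quotient_monoid :: "('a, 'b) monoid_scheme \<Rightarrow> ('a \<times> 'a) set \<Rightarrow> 'a set monoid" where
  "quotient_monoid M r =
    \<lparr>carrier = carrier M // r,
     monoid.mult = (\<lambda>A B. \<Union>a\<in>A. \<Union>b\<in>B. r `` {a \<otimes>\<^bsub>M\<^esub> b}),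
     one = r `` {\<one>\<^bsub>M\<^esub>}\<rparr>"

text \<open>The pair \<open>(a, b)\<close> stands for the formal difference \<open>a - b\<close>; cancellativity makes this relation
  transitive.\<close>

definition fraction_rel :: "('a, 'b) monoid_scheme \<Rightarrow> (('a \<times> 'a) \<times> ('a \<times> 'a)) set" where
  "fraction_rel M =
    {((a, b), (c, d)). a \<in> carrier M \<and> b \<in> carrier M \<and> c \<in> carrier M \<and> d \<in> carrier M \<and>
      a \<otimes>\<^bsub>M\<^esub> d = c \<otimes>\<^bsub>M\<^esub> b}"

definition quotient_group :: "('a, 'b) monoid_scheme \<Rightarrow> ('a \<times> 'a) set monoid" where
  "quotient_group M = quotient_monoid (M \<times>\<times> M) (fraction_rel M)"

definition quotient_group_embed :: "('a, 'b) monoid_scheme \<Rightarrow> 'a \<Rightarrow> ('a \<times> 'a) set" where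
  "quotient_group_embed M x = fraction_rel M `` {(x, \<one>\<^bsub>M\<^esub>)}"

definition root_closed :: "('a, 'b) monoid_scheme \<Rightarrow> bool" where
  "root_closed M \<longleftrightarrow>
    (\<forall>z \<in> carrier (quotient_group M). \<forall>n::nat. n > 0 \<longrightarrow>
      z [^]\<^bsub>quotient_group M\<^esub> n \<in> quotient_group_embed M ` carrier M \<longrightarrow>
      z \<in> quotient_group_embed M ` carrier M)"

definition submonoid_congruence :: "('a, 'b) monoid_scheme \<Rightarrow> 'a set \<Rightarrow> ('a \<times> 'a) set" where
  "submonoid_congruence S T =
    {(s, s'). s \<in> carrier S \<and> s' \<in> carrier S \<and>
      quotient_group_embed S s' \<otimes>\<^bsub>quotient_group S\<^esub>
        inv\<^bsub>quotient_group S\<^esub> (quotient_group_embed S s)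
      \<in> generate (quotient_group S) (quotient_group_embed S ` T)}"

definition quotient_by_submonoid :: "('a, 'b) monoid_scheme \<Rightarrow> 'a set \<Rightarrow> 'a set monoid" where
  "quotient_by_submonoid S T = quotient_monoid S (submonoid_congruence S T)"

subsection \<open>Inside factorial monoids and Cale monoids\<close>

definition submonoid_generated :: "('a, 'b) monoid_scheme \<Rightarrow> 'a set \<Rightarrow> 'a set" where
  "submonoid_generated M Q = (\<lambda>H. submonoid H M) hull Q"

locale reduced_monoid = comm_monoid_cancel M for M :: "('a, 'b) monoid_scheme" (structure) +
  assumes reduced: "Units M = {\<one>}"

text \<open>Since \<open>finprod\<close> is meaningful only over finite sets, the product over the possibly infinite
  set \<open>Q\<close> is restricted to the support of the exponents.\<close>

locale inside_factorial_monoid = reduced_monoid M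
  for M :: "('a, 'b) monoid_scheme" (structure) and Q :: "'a set" +
  assumes base_subset: "Q \<subseteq> carrier M - {\<one>}"
    and power_in_generated:
      "\<And>x. x \<in> carrier M \<Longrightarrow> \<exists>n::nat. n > 0 \<and> x [^] n \<in> submonoid_generated M Q"
    and unique_exponents:
      "\<And>f g :: 'a \<Rightarrow> nat.
        \<lbrakk>finite {q \<in> Q. f q \<noteq> 0}; finite {q \<in> Q. g q \<noteq> 0};
         (\<Otimes>q \<in> {q \<in> Q. f q \<noteq> 0}. q [^] f q) = (\<Otimes>q \<in> {q \<in> Q. g q \<noteq> 0}. q [^] g q)\<rbrakk>
        \<Longrightarrow> \<forall>q \<in> Q. f q = g q"

text \<open>The function \<open>\<lambda>(x, y)\<close>; the supremum is taken in \<open>[0, \<infinity>]\<close>, so that it always exists.\<close>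

definition extraction_degree :: "('a, 'b) monoid_scheme \<Rightarrow> 'a \<Rightarrow> 'a \<Rightarrow> ennreal" where
  "extraction_degree M x y =
    Sup {of_nat m / of_nat n | m n :: nat. n > 0 \<and> (x [^]\<^bsub>M\<^esub> m) divides\<^bsub>M\<^esub> (y [^]\<^bsub>M\<^esub> n)}"

definition tame_at :: "('a, 'b) monoid_scheme \<Rightarrow> 'a \<Rightarrow> nat \<Rightarrow> bool" where
  "tame_at M q l \<longleftrightarrow> l > 0 \<and> (\<forall>x \<in> carrier M. of_nat l * extraction_degree M q x \<in> \<nat>)"

definition tame_level :: "('a, 'b) monoid_scheme \<Rightarrow> 'a \<Rightarrow> nat" where
  "tame_level M q = (LEAST l. tame_at M q l)"

locale cale_monoid = inside_factorial_monoid M Q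
  for M :: "('a, 'b) monoid_scheme" (structure) and Q :: "'a set" +
  assumes tame: "\<And>q. q \<in> Q \<Longrightarrow> \<exists>l. tame_at M q l"

subsection \<open>The inner class group\<close>

text \<open>The monoid \<open>\<nat>\<^bsup>(Q)\<^esup>\<close>: its elements are represented by the functions on the whole type that
  vanish outside \<open>Q\<close> and have finite support.\<close>

definition finsupp_monoid :: "'a set \<Rightarrow> ('a \<Rightarrow> nat) monoid" where
  "finsupp_monoid Q =
    \<lparr>carrier = {f. finite {q. f q \<noteq> 0} \<and> {q. f q \<noteq> 0} \<subseteq> Q},
     monoid.mult = (\<lambda>f g q. f q + g q),
     one = (\<lambda>q. 0)\<rparr>"

definition cale_map :: "('a, 'b) monoid_scheme \<Rightarrow> 'a set \<Rightarrow> 'a \<Rightarrow> 'a \<Rightarrow> nat" where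
  "cale_map M Q x =
    (\<lambda>q. if q \<in> Q
         then (THE k::nat. of_nat k = of_nat (tame_level M q) * extraction_degree M q x)
         else 0)"

definition inner_class_group :: "('a, 'b) monoid_scheme \<Rightarrow> 'a set \<Rightarrow> ('a \<Rightarrow> nat) set monoid" where
  "inner_class_group M Q =
    quotient_by_submonoid
      ((finsupp_monoid Q)\<lparr>carrier := cale_map M Q ` carrier M\<rparr>)
      (cale_map M Q ` submonoid_generated M Q)"

subsection \<open>The Apery set\<close>

definition apery_set :: "('a, 'b) monoid_scheme \<Rightarrow> 'a set \<Rightarrow> 'a set" where
  "apery_set M Q = carrier M - (Q <#>\<^bsub>M\<^esub> carrier M)"

definition apery_monoid :: "('a, 'b) monoid_scheme \<Rightarrow> 'a set \<Rightarrow> 'a monoid" where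
  "apery_monoid M Q =
    \<lparr>carrier = apery_set M Q,
     monoid.mult = (\<lambda>a b. THE c. c \<in> apery_set M Q \<and> a \<otimes>\<^bsub>M\<^esub> b \<in> c <#\<^bsub>M\<^esub> submonoid_generated M Q),
     one = \<one>\<^bsub>M\<^esub>\<rparr>"

end

theory Submission
  imports Defs
begin

text \<open>
  Let \<open>\<ell> q\<close> be the tame level of \<open>q\<close> and \<open>\<phi>\<close> the Cale map. Root-closedness makes divisibility in
  \<open>M\<close> visible on exponents: \<open>x\<close> divides \<open>y\<close> as soon as \<open>\<phi> x \<le> \<phi> y\<close> pointwise
  (\<open>divides_of_cale_map_le\<close>). Moreover \<open>\<phi> q\<close> is \<open>\<ell> q\<close> at \<open>q\<close> and \<open>0\<close> elsewhere, so that
  \<open>\<phi>\<close> maps \<open>\<langle>Q\<rangle>\<close> onto the finitely supported functions on \<open>Q\<close> whose value at each \<open>q\<close> is a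
  multiple of \<open>\<ell> q\<close>, and the Apery set consists of the \<open>c\<close> with \<open>\<phi> c q < \<ell> q\<close> for all
  \<open>q \<in> Q\<close> (\<open>apery_set_iff\<close>).

  Writing \<open>x = c + f\<close> with \<open>c\<close> in the Apery set and \<open>f \<in> \<langle>Q\<rangle>\<close> is therefore Euclidean division
  of \<open>\<phi> x q\<close> by \<open>\<ell> q\<close>, simultaneously for all \<open>q\<close>: the element \<open>f\<close> with the quotients as
  exponents lies in \<open>M\<close>, it divides \<open>x\<close> by root-closedness, and the complement \<open>c\<close> carries
  the remainders (\<open>apery_remainder_exists\<close>). On the other side, two elements of \<open>\<phi> M\<close> are
  congruent modulo \<open>\<phi> \<langle>Q\<rangle>\<close> exactly if their values at each \<open>q\<close> agree modulo \<open>\<ell> q\<close>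
  (\<open>cale_congruence_iff\<close>). Hence each class contains \<open>\<phi> c\<close> for exactly one \<open>c\<close> in the Apery set,
  and adding classes corresponds to adding Apery elements and taking the remainder.
\<close>

section \<open>Quotients by congruences\<close>

locale monoid_congruence = monoid M for M :: "('a, 'b) monoid_scheme" (structure) +
  fixes r :: "('a \<times> 'a) set"
  assumes equiv: "equiv (carrier M) r"
    and mult_compat: "\<lbrakk>(a, a') \<in> r; (b, b') \<in> r\<rbrakk> \<Longrightarrow> (a \<otimes> b, a' \<otimes> b') \<in> r"
begin

lemma carrier_quotient: "carrier (quotient_monoid M r) = (\<lambda>a. r `` {a}) ` carrier M"
  by (auto simp: quotient_monoid_def quotient_def)

lemma one_quotient: "\<one>\<^bsub>quotient_monoid M r\<^esub> = r `` {\<one>}"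
  by (simp add: quotient_monoid_def)

lemma mult_quotient:
  assumes "a \<in> carrier M" "b \<in> carrier M"
  shows "r `` {a} \<otimes>\<^bsub>quotient_monoid M r\<^esub> r `` {b} = r `` {a \<otimes> b}"
proof -
  have const: "r `` {a' \<otimes> b'} = r `` {a \<otimes> b}" if "a' \<in> r `` {a}" "b' \<in> r `` {b}" for a' b'
    using that mult_compat[of a a' b b'] equiv_class_eq[OF equiv] by force
  have nonempty: "r `` {a} \<noteq> {}" "r `` {b} \<noteq> {}"
    using equiv_class_self[OF equiv] assms by auto
  have "(\<Union>b'\<in>r `` {b}. r `` {a' \<otimes> b'}) = r `` {a \<otimes> b}" if "a' \<in> r `` {a}" for a'
    by (rule SUP_eq_const[OF nonempty(2)]) (rule const[OF that])
  then have "(\<Union>a'\<in>r `` {a}. \<Union>b'\<in>r `` {b}. r `` {a' \<otimes> b'}) = r `` {a \<otimes> b}"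
    by (rule SUP_eq_const[OF nonempty(1)])
  then show ?thesis by (simp add: quotient_monoid_def)
qed

lemma class_eq_iff:
  assumes "a \<in> carrier M" "b \<in> carrier M"
  shows "r `` {a} = r `` {b} \<longleftrightarrow> (a, b) \<in> r"
  using eq_equiv_class_iff[OF equiv assms] .

end

section \<open>The quotient group\<close>

context comm_monoid_cancel
begin

abbreviation quotient_grp ("\<G>") where
  "\<G> \<equiv> quotient_group G"

text \<open>The class of the formal difference \<open>a - b\<close>.\<close>

definition diff_class :: "'a \<Rightarrow> 'a \<Rightarrow> ('a \<times> 'a) set" where
  "diff_class a b = fraction_rel G `` {(a, b)}"

lemma fraction_rel_congruence: "monoid_congruence (G \<times>\<times> G) (fraction_rel G)"
proof -
  have trans: "a \<otimes> f = e \<otimes> b"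
    if "a \<otimes> d = c \<otimes> b" "c \<otimes> f = e \<otimes> d"
      and carr: "a \<in> carrier G" "b \<in> carrier G" "c \<in> carrier G" "d \<in> carrier G"
        "e \<in> carrier G" "f \<in> carrier G" for a b c d e f
  proof -
    have "(a \<otimes> f) \<otimes> d = (a \<otimes> d) \<otimes> f" using carr by (simp add: m_ac)
    also have "\<dots> = (c \<otimes> f) \<otimes> b" using that(1) carr by (simp add: m_ac)
    also have "\<dots> = (e \<otimes> b) \<otimes> d" using that(2) carr by (simp add: m_ac)
    finally show ?thesis using carr by (meson m_closed r_cancel)
  qed
  have equiv: "equiv (carrier (G \<times>\<times> G)) (fraction_rel G)"
  proof (rule equivI)
    show "trans (fraction_rel G)"
      unfolding trans_def fraction_rel_def using trans by blast
  qed (auto simp: fraction_rel_def refl_on_def sym_def)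
  have mult: "(a \<otimes> a') \<otimes> (d \<otimes> d') = (c \<otimes> c') \<otimes> (b \<otimes> b')"
    if eq: "a \<otimes> d = c \<otimes> b" "a' \<otimes> d' = c' \<otimes> b'"
      and carr: "a \<in> carrier G" "b \<in> carrier G" "c \<in> carrier G" "d \<in> carrier G"
        "a' \<in> carrier G" "b' \<in> carrier G" "c' \<in> carrier G" "d' \<in> carrier G"
    for a b c d a' b' c' d'
  proof -
    have "(a \<otimes> a') \<otimes> (d \<otimes> d') = (a \<otimes> d) \<otimes> (a' \<otimes> d')" using carr by (simp add: m_ac)
    also have "\<dots> = (c \<otimes> c') \<otimes> (b \<otimes> b')" unfolding eq using carr by (simp add: m_ac)
    finally show ?thesis .
  qed
  have compat: "(p \<otimes>\<^bsub>G \<times>\<times> G\<^esub> q, p' \<otimes>\<^bsub>G \<times>\<times> G\<^esub> q') \<in> fraction_rel G"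
    if "(p, p') \<in> fraction_rel G" "(q, q') \<in> fraction_rel G" for p p' q q'
    using that mult[of "fst p" "snd p'" "fst p'" "snd p" "fst q" "snd q'" "fst q'" "snd q"]
    by (cases p; cases p'; cases q; cases q') (simp add: fraction_rel_def)
  show ?thesis
    by (intro monoid_congruence.intro monoid_congruence_axioms.intro DirProd_monoid
        monoid_axioms equiv compat)
qed

lemma carrier_quotient_group:
  "carrier \<G> = {diff_class a b | a b. a \<in> carrier G \<and> b \<in> carrier G}"
  unfolding quotient_group_def diff_class_def
    monoid_congruence.carrier_quotient[OF fraction_rel_congruence] by auto

lemma diff_class_closed:
  "\<lbrakk>a \<in> carrier G; b \<in> carrier G\<rbrakk> \<Longrightarrow> diff_class a b \<in> carrier \<G>"
  by (auto simp: carrier_quotient_group)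

lemma diff_class_mult:
  assumes "a \<in> carrier G" "b \<in> carrier G" "c \<in> carrier G" "d \<in> carrier G"
  shows "diff_class a b \<otimes>\<^bsub>\<G>\<^esub> diff_class c d = diff_class (a \<otimes> c) (b \<otimes> d)"
  using assms monoid_congruence.mult_quotient[OF fraction_rel_congruence, of "(a, b)" "(c, d)"]
  by (simp add: quotient_group_def diff_class_def)

lemma diff_class_one: "\<one>\<^bsub>\<G>\<^esub> = diff_class \<one> \<one>"
  unfolding quotient_group_def diff_class_def
    monoid_congruence.one_quotient[OF fraction_rel_congruence] by simp

lemma diff_class_eq_iff:
  assumes "a \<in> carrier G" "b \<in> carrier G" "c \<in> carrier G" "d \<in> carrier G"
  shows "diff_class a b = diff_class c d \<longleftrightarrow> a \<otimes> d = c \<otimes> b"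
  using assms monoid_congruence.class_eq_iff[OF fraction_rel_congruence, of "(a, b)" "(c, d)"]
  by (simp add: diff_class_def fraction_rel_def)

lemma embed_eq_diff_class: "quotient_group_embed G a = diff_class a \<one>"
  by (simp add: quotient_group_embed_def diff_class_def)

lemma diff_class_opposite:
  assumes "a \<in> carrier G" "b \<in> carrier G"
  shows "diff_class b a \<otimes>\<^bsub>\<G>\<^esub> diff_class a b = \<one>\<^bsub>\<G>\<^esub>"
  using assms by (simp add: diff_class_mult diff_class_one diff_class_eq_iff m_comm)

lemma quotient_group_comm_group: "comm_group \<G>"
proof (rule comm_groupI)
  fix x y assume x: "x \<in> carrier \<G>" and y: "y \<in> carrier \<G>"
  show "x \<otimes>\<^bsub>\<G>\<^esub> y \<in> carrier \<G>"
    using x y m_closed by (force simp: carrier_quotient_group diff_class_mult)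
  show "x \<otimes>\<^bsub>\<G>\<^esub> y = y \<otimes>\<^bsub>\<G>\<^esub> x"
    using x y by (auto simp: carrier_quotient_group diff_class_mult m_comm)
  show "(x \<otimes>\<^bsub>\<G>\<^esub> y) \<otimes>\<^bsub>\<G>\<^esub> z = x \<otimes>\<^bsub>\<G>\<^esub> (y \<otimes>\<^bsub>\<G>\<^esub> z)" if "z \<in> carrier \<G>" for z
    using x y that by (auto simp: carrier_quotient_group diff_class_mult m_assoc)
next
  fix x assume "x \<in> carrier \<G>"
  then obtain a b where x: "x = diff_class a b" and ab: "a \<in> carrier G" "b \<in> carrier G"
    by (auto simp: carrier_quotient_group)
  show "\<one>\<^bsub>\<G>\<^esub> \<otimes>\<^bsub>\<G>\<^esub> x = x"
    using ab by (simp add: x diff_class_mult diff_class_one)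
  show "\<exists>y\<in>carrier \<G>. y \<otimes>\<^bsub>\<G>\<^esub> x = \<one>\<^bsub>\<G>\<^esub>"
    using diff_class_opposite[OF ab] diff_class_closed ab x by blast
qed (auto simp: diff_class_one intro: diff_class_closed)

lemma inv_diff_class:
  assumes "a \<in> carrier G" "b \<in> carrier G"
  shows "inv\<^bsub>\<G>\<^esub> (diff_class a b) = diff_class b a"
  using group.inv_equality[OF comm_group.axioms(2)[OF quotient_group_comm_group]
      diff_class_opposite[OF assms]] assms
  by (simp add: diff_class_closed)

lemma diff_class_pow:
  assumes "a \<in> carrier G" "b \<in> carrier G"
  shows "diff_class a b [^]\<^bsub>\<G>\<^esub> (n::nat) = diff_class (a [^] n) (b [^] n)"
proof (induction n)
  case 0
  then show ?case by (simp add: diff_class_one)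
next
  case (Suc n)
  interpret \<G>: comm_group \<G> by (rule quotient_group_comm_group)
  show ?case using assms Suc by (simp add: diff_class_mult)
qed

text \<open>Root-closedness is used only in this form: it is applied to the difference \<open>y - x\<close>, and the
  conclusion no longer mentions the quotient group.\<close>

lemma root_closed_divides:
  assumes rc: "root_closed G" and n: "n > 0"
    and x: "x \<in> carrier G" and y: "y \<in> carrier G"
    and dvd: "(x [^] (n::nat)) divides (y [^] n)"
  shows "x divides y"
proof -
  obtain w where w: "w \<in> carrier G" "y [^] n = x [^] n \<otimes> w"
    using dvd by auto
  have "diff_class y x [^]\<^bsub>\<G>\<^esub> n = quotient_group_embed G w"
    using w x y by (simp add: diff_class_pow embed_eq_diff_class diff_class_eq_iff m_comm)
  then have "diff_class y x \<in> quotient_group_embed G ` carrier G"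
    using rc n w(1) diff_class_closed[OF y x] unfolding root_closed_def by blast
  then obtain v where "v \<in> carrier G" "diff_class y x = diff_class v \<one>"
    by (auto simp: embed_eq_diff_class)
  then show ?thesis
    using x y by (auto simp: diff_class_eq_iff m_comm factor_def)
qed

lemma generate_submonoid:
  assumes "submonoid T G"
  shows "generate \<G> (quotient_group_embed G ` T) = {diff_class t t' | t t'. t \<in> T \<and> t' \<in> T}"
proof -
  interpret T: submonoid T G by fact
  have carr: "t \<in> carrier G" if "t \<in> T" for t using that T.subset by blast
  show ?thesis
  proof (intro equalityI subsetI)
    fix z assume "z \<in> generate \<G> (quotient_group_embed G ` T)"
    then show "z \<in> {diff_class t t' | t t'. t \<in> T \<and> t' \<in> T}"
    proof induction
      case one
      then show ?case using diff_class_one T.one_closed by blast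
    next
      case (incl h)
      then show ?case using embed_eq_diff_class T.one_closed by blast
    next
      case (inv h)
      then obtain t where "t \<in> T" "h = diff_class t \<one>" by (auto simp: embed_eq_diff_class)
      then have "inv\<^bsub>\<G>\<^esub> h = diff_class \<one> t" by (simp add: inv_diff_class carr)
      then show ?case using \<open>t \<in> T\<close> T.one_closed by blast
    next
      case (eng h1 h2)
      then obtain t1 t1' t2 t2' where t: "t1 \<in> T" "t1' \<in> T" "t2 \<in> T" "t2' \<in> T"
        and h: "h1 = diff_class t1 t1'" "h2 = diff_class t2 t2'" by blast
      have "h1 \<otimes>\<^bsub>\<G>\<^esub> h2 = diff_class (t1 \<otimes> t2) (t1' \<otimes> t2')"
        using t h by (simp add: diff_class_mult carr)
      then show ?case using t T.m_closed by blast
    qed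
  next
    fix z assume "z \<in> {diff_class t t' | t t'. t \<in> T \<and> t' \<in> T}"
    then obtain t t' where t: "t \<in> T" "t' \<in> T" and z: "z = diff_class t t'" by blast
    have "z = quotient_group_embed G t \<otimes>\<^bsub>\<G>\<^esub> inv\<^bsub>\<G>\<^esub> (quotient_group_embed G t')"
      using t by (simp add: z embed_eq_diff_class inv_diff_class diff_class_mult carr)
    then show "z \<in> generate \<G> (quotient_group_embed G ` T)"
      using t by (auto intro: generate.intros)
  qed
qed

text \<open>The subgroup generated by \<open>T\<close> consists of the differences of elements of \<open>T\<close>; equating such a
  difference with \<open>s' - s\<close> and moving the negative terms across gives an equation in the monoid.\<close>

lemma submonoid_congruence_iff:
  assumes "submonoid T G"
  shows "(s, s') \<in> submonoid_congruence G T \<longleftrightarrow>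
    s \<in> carrier G \<and> s' \<in> carrier G \<and> (\<exists>t\<in>T. \<exists>t'\<in>T. s' \<otimes> t' = t \<otimes> s)"
proof -
  have T: "t \<in> carrier G" if "t \<in> T" for t
    using that assms submonoid.subset by blast
  have "quotient_group_embed G s' \<otimes>\<^bsub>\<G>\<^esub> inv\<^bsub>\<G>\<^esub> (quotient_group_embed G s)
      \<in> generate \<G> (quotient_group_embed G ` T) \<longleftrightarrow> (\<exists>t\<in>T. \<exists>t'\<in>T. s' \<otimes> t' = t \<otimes> s)"
    if s: "s \<in> carrier G" "s' \<in> carrier G"
  proof -
    have diff: "quotient_group_embed G s' \<otimes>\<^bsub>\<G>\<^esub> inv\<^bsub>\<G>\<^esub> (quotient_group_embed G s) = diff_class s' s"
      using s by (simp add: embed_eq_diff_class inv_diff_class diff_class_mult)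
    have "diff_class s' s = diff_class t t' \<longleftrightarrow> s' \<otimes> t' = t \<otimes> s"
      if "t \<in> T" "t' \<in> T" for t t'
      using s that T by (simp add: diff_class_eq_iff)
    then show ?thesis
      unfolding diff generate_submonoid[OF assms] mem_Collect_eq by metis
  qed
  then show ?thesis unfolding submonoid_congruence_def by auto
qed

end

section \<open>Products of base elements\<close>

context inside_factorial_monoid
begin

abbreviation exponents :: "('a \<Rightarrow> nat) set" where
  "exponents \<equiv> carrier (finsupp_monoid Q)"

lemma exponents_iff: "f \<in> exponents \<longleftrightarrow> finite {q. f q \<noteq> 0} \<and> {q. f q \<noteq> 0} \<subseteq> Q"
  by (simp add: finsupp_monoid_def)

lemma exponents_mono: "\<lbrakk>g \<in> exponents; \<And>q. f q \<noteq> 0 \<Longrightarrow> g q \<noteq> 0\<rbrakk> \<Longrightarrow> f \<in> exponents"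
  unfolding exponents_iff by (metis (mono_tags, lifting) mem_Collect_eq rev_finite_subset subset_iff)

lemma exponents_add: "\<lbrakk>f \<in> exponents; g \<in> exponents\<rbrakk> \<Longrightarrow> (\<lambda>q. f q + g q) \<in> exponents"
  unfolding exponents_iff
  by (rule conjI, rule finite_subset[of _ "{q. f q \<noteq> 0} \<union> {q. g q \<noteq> 0}"]) auto

lemma exponents_scale: "f \<in> exponents \<Longrightarrow> (\<lambda>q. k q * f q) \<in> exponents"
  by (rule exponents_mono) auto

lemma exponents_zero: "(\<lambda>q. 0) \<in> exponents"
  by (simp add: exponents_iff)

definition base_prod :: "('a \<Rightarrow> nat) \<Rightarrow> 'a" where
  "base_prod f = (\<Otimes>q \<in> {q \<in> Q. f q \<noteq> 0}. q [^] f q)"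

lemma base_closed: "q \<in> Q \<Longrightarrow> q \<in> carrier M"
  using base_subset by blast

lemma base_prod_closed: "base_prod f \<in> carrier M"
  unfolding base_prod_def by (rule finprod_closed) (auto intro: base_closed)

lemma base_prod_superset:
  assumes "finite B" "B \<subseteq> Q" "\<And>q. f q \<noteq> 0 \<Longrightarrow> q \<in> B"
  shows "base_prod f = (\<Otimes>q \<in> B. q [^] f q)"
  unfolding base_prod_def
proof (rule finprod_mono_neutral_cong_left)
  show "(\<lambda>q. q [^] f q) \<in> B \<rightarrow> carrier M" using assms(2) by (auto intro: base_closed)
qed (use assms in auto)

lemma base_prod_add:
  assumes "f \<in> exponents" "g \<in> exponents"
  shows "base_prod (\<lambda>q. f q + g q) = base_prod f \<otimes> base_prod g"
proof -
  let ?B = "{q. f q \<noteq> 0} \<union> {q. g q \<noteq> 0}"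
  have B: "finite ?B" "?B \<subseteq> Q" using assms by (auto simp: exponents_iff)
  have "base_prod (\<lambda>q. f q + g q) = (\<Otimes>q \<in> ?B. q [^] (f q + g q))"
    by (rule base_prod_superset[OF B]) auto
  also have "\<dots> = (\<Otimes>q \<in> ?B. q [^] f q \<otimes> q [^] g q)"
    by (rule finprod_cong') (use B(2) in \<open>auto simp: nat_pow_mult base_closed subset_iff\<close>)
  also have "\<dots> = (\<Otimes>q \<in> ?B. q [^] f q) \<otimes> (\<Otimes>q \<in> ?B. q [^] g q)"
    by (rule finprod_multf) (use B(2) in \<open>auto simp: base_closed subset_iff\<close>)
  also have "(\<Otimes>q \<in> ?B. q [^] f q) = base_prod f"
    by (rule base_prod_superset[OF B, symmetric]) auto
  also have "(\<Otimes>q \<in> ?B. q [^] g q) = base_prod g"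
    by (rule base_prod_superset[OF B, symmetric]) auto
  finally show ?thesis .
qed

lemma base_prod_zero: "base_prod (\<lambda>q. 0) = \<one>"
  by (simp add: base_prod_def)

lemma base_prod_scale:
  assumes "f \<in> exponents"
  shows "base_prod (\<lambda>q. n * f q) = base_prod f [^] (n::nat)"
proof (induction n)
  case 0
  then show ?case by (simp add: base_prod_zero)
next
  case (Suc n)
  have "base_prod (\<lambda>q. n * f q + f q) = base_prod (\<lambda>q. n * f q) \<otimes> base_prod f"
    by (rule base_prod_add[OF exponents_scale]) (use assms in auto)
  then show ?case using Suc by (simp add: add.commute)
qed

definition single_exponent :: "'a \<Rightarrow> nat \<Rightarrow> 'a \<Rightarrow> nat" where
  "single_exponent q n = (\<lambda>p. if p = q then n else 0)"

lemma single_exponents: "q \<in> Q \<Longrightarrow> single_exponent q n \<in> exponents"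
  by (auto simp: single_exponent_def exponents_iff)

lemma base_prod_single: "q \<in> Q \<Longrightarrow> base_prod (single_exponent q n) = q [^] n"
  by (subst base_prod_superset[of "{q}"])
     (auto simp: single_exponent_def base_closed split: if_splits)

lemma base_prod_mono:
  assumes "g \<in> exponents" "\<And>q. f q \<le> g q"
  shows "base_prod f divides base_prod g"
proof -
  have "f \<in> exponents"
    by (rule exponents_mono[OF assms(1)]) (use assms(2) in \<open>metis le_zero_eq\<close>)
  moreover have "(\<lambda>q. g q - f q) \<in> exponents"
    by (rule exponents_mono[OF assms(1)]) auto
  ultimately have "base_prod (\<lambda>q. f q + (g q - f q)) = base_prod f \<otimes> base_prod (\<lambda>q. g q - f q)"
    by (rule base_prod_add)
  then show ?thesis using assms(2) base_prod_closed by (auto simp: factor_def)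
qed

lemma base_prod_inject:
  assumes "f \<in> exponents" "g \<in> exponents" "base_prod f = base_prod g"
  shows "f = g"
proof -
  have "\<forall>q\<in>Q. f q = g q"
    using assms by (intro unique_exponents) (auto simp: base_prod_def exponents_iff)
  moreover have "f q = g q" if "q \<notin> Q" for q
  proof -
    have "f q = 0" "g q = 0" using assms(1,2) that by (auto simp: exponents_iff)
    then show ?thesis by simp
  qed
  ultimately show ?thesis by blast
qed

lemma base_prod_submonoid: "submonoid (base_prod ` exponents) M"
proof
  fix x y assume "x \<in> base_prod ` exponents" "y \<in> base_prod ` exponents"
  then obtain f g where "f \<in> exponents" "g \<in> exponents" "x = base_prod f" "y = base_prod g"
    by blast
  then have "x \<otimes> y = base_prod (\<lambda>q. f q + g q)" "(\<lambda>q. f q + g q) \<in> exponents"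
    by (simp_all add: base_prod_add exponents_add)
  then show "x \<otimes> y \<in> base_prod ` exponents" by blast
next
  show "\<one> \<in> base_prod ` exponents" using base_prod_zero exponents_zero by (metis image_eqI)
qed (auto simp: base_prod_closed)

lemma submonoid_generated_eq: "submonoid_generated M Q = base_prod ` exponents"
  unfolding submonoid_generated_def
proof (rule hull_unique)
  show "Q \<subseteq> base_prod ` exponents"
  proof
    fix q assume "q \<in> Q"
    then have "q = base_prod (single_exponent q 1)" "single_exponent q 1 \<in> exponents"
      by (simp_all add: base_prod_single single_exponents base_closed)
    then show "q \<in> base_prod ` exponents" by blast
  qed
  show "submonoid (base_prod ` exponents) M" by (rule base_prod_submonoid)
next
  fix T assume "Q \<subseteq> T" and "submonoid T M"
  interpret T: submonoid T M by fact
  have pow: "q [^] n \<in> T" if "q \<in> Q" for q and n :: nat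
    using that \<open>Q \<subseteq> T\<close> by (induction n) auto
  have "(\<Otimes>q \<in> B. q [^] f q) \<in> T" if "finite B" "B \<subseteq> Q" for B and f :: "'a \<Rightarrow> nat"
    using that by induction (auto simp: pow base_closed subset_iff Pi_iff)
  then show "base_prod ` exponents \<subseteq> T"
    unfolding base_prod_def by (auto simp: exponents_iff)
qed

lemma submonoid_generated_submonoid: "submonoid (submonoid_generated M Q) M"
  unfolding submonoid_generated_eq by (rule base_prod_submonoid)

lemma power_eq_base_prod:
  assumes "x \<in> carrier M"
  obtains n f where "n > 0" "f \<in> exponents" "x [^] (n::nat) = base_prod f"
  using power_in_generated[OF assms] unfolding submonoid_generated_eq by blast

section \<open>Extraction degrees and the Cale map\<close>

text \<open>The supremum is attained, since \<open>q\<close> to the \<open>f q\<close> divides \<open>x\<^sup>n\<close>. It is an upper bound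
  because a relation \<open>q\<^sup>m \<le> x\<^sup>k\<close> can be raised to a power for which the complement, too, is a
  product of base elements; there exponents can be compared.\<close>

lemma extraction_degree_eq:
  assumes n: "n > 0" and f: "f \<in> exponents" and xn: "x [^] (n::nat) = base_prod f"
    and x: "x \<in> carrier M" and q: "q \<in> Q"
  shows "extraction_degree M q x = of_nat (f q) / of_nat n"
  unfolding extraction_degree_def
proof (rule antisym)
  have "m * n \<le> f q * k" if k: "k > 0" and dvd: "(q [^] m) divides (x [^] k)" for m k :: nat
  proof -
    obtain y where y: "y \<in> carrier M" "x [^] k = q [^] m \<otimes> y"
      using dvd by auto
    obtain j g where j: "j > 0" and g: "g \<in> exponents" and yj: "y [^] (j::nat) = base_prod g"
      using power_eq_base_prod[OF y(1)] by blast
    have qc: "q \<in> carrier M" using q by (rule base_closed)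
    have "base_prod (\<lambda>p. (k * j) * f p) = (x [^] n) [^] (k * j)"
      by (simp add: base_prod_scale f xn)
    also have "\<dots> = (x [^] k) [^] (n * j)"
      using x by (simp add: nat_pow_pow mult_ac)
    also have "\<dots> = (q [^] m) [^] (n * j) \<otimes> y [^] (n * j)"
      unfolding y(2) using qc y(1) by (simp add: pow_mult_distrib m_comm)
    also have "\<dots> = q [^] (m * n * j) \<otimes> (y [^] j) [^] n"
      using qc y(1) by (simp add: nat_pow_pow mult_ac)
    also have "\<dots> = base_prod (single_exponent q (m * n * j)) \<otimes> base_prod (\<lambda>p. n * g p)"
      using q by (simp add: base_prod_single base_prod_scale g yj)
    also have "\<dots> = base_prod (\<lambda>p. single_exponent q (m * n * j) p + n * g p)"
      using q g by (simp add: base_prod_add single_exponents exponents_scale)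
    finally have "(\<lambda>p. (k * j) * f p) = (\<lambda>p. single_exponent q (m * n * j) p + n * g p)"
      by (intro base_prod_inject exponents_add exponents_scale single_exponents f g q)
    from fun_cong[OF this, of q] have "m * n * j \<le> f q * k * j"
      by (simp add: single_exponent_def mult_ac)
    then show ?thesis using j by simp
  qed
  moreover have "of_nat m / of_nat k \<le> (of_nat i / of_nat n :: ennreal)"
    if "k > 0" "m * n \<le> i * k" for m k i :: nat
  proof -
    have "real m / real k \<le> real i / real n"
      using that n by (simp add: divide_simps) (simp flip: of_nat_mult add: mult_ac)
    then show ?thesis
      using that n by (simp add: ennreal_of_nat_eq_real_of_nat divide_ennreal)
  qed
  ultimately show "Sup {of_nat m / of_nat k | m k :: nat. k > 0 \<and> (q [^] m) divides (x [^] k)}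
      \<le> (of_nat (f q) / of_nat n :: ennreal)"
    by (auto intro!: Sup_least)
next
  have "base_prod (single_exponent q (f q)) divides base_prod f"
    by (rule base_prod_mono) (auto simp: f single_exponent_def)
  then have "(q [^] f q) divides (x [^] n)" by (simp add: base_prod_single q xn)
  then show "(of_nat (f q) / of_nat n :: ennreal)
      \<le> Sup {of_nat m / of_nat k | m k :: nat. k > 0 \<and> (q [^] m) divides (x [^] k)}"
    using n by (intro Sup_upper) blast
qed

end

context cale_monoid
begin

abbreviation level ("\<ell>") where "\<ell> \<equiv> tame_level M"
abbreviation cale_mor ("\<phi>") where "\<phi> \<equiv> cale_map M Q"

lemma tame_at_level: "q \<in> Q \<Longrightarrow> tame_at M q (\<ell> q)"
  unfolding tame_level_def using tame by (blast intro: LeastI_ex)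

lemma level_pos: "q \<in> Q \<Longrightarrow> \<ell> q > 0"
  using tame_at_level by (simp add: tame_at_def)

lemma cale_map_outside: "q \<notin> Q \<Longrightarrow> \<phi> x q = 0"
  by (simp add: cale_map_def)

text \<open>This relation in \<open>\<nat>\<close> determines \<open>\<phi> x\<close>; everything below is derived from it, without further
  reference to suprema.\<close>

lemma cale_map_eq:
  assumes n: "n > 0" and f: "f \<in> exponents" and xn: "x [^] (n::nat) = base_prod f"
    and x: "x \<in> carrier M"
  shows "n * \<phi> x q = \<ell> q * f q"
proof (cases "q \<in> Q")
  case True
  let ?e = "extraction_degree M q x"
  have "of_nat (\<ell> q) * ?e \<in> \<nat>"
    using tame_at_level[OF True] x by (simp add: tame_at_def)
  then obtain k where k: "of_nat (\<ell> q) * ?e = of_nat k" by (rule Nats_cases)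
  have "\<phi> x q = k"
    unfolding cale_map_def using True by (auto simp: k)
  moreover have "real (\<ell> q) * (real (f q) / real n) = real k"
  proof -
    have "ennreal (real (\<ell> q) * (real (f q) / real n)) =
        ennreal (real (\<ell> q)) * ennreal (real (f q) / real n)"
      by (rule ennreal_mult) auto
    also have "\<dots> = ennreal (real k)"
      using k n unfolding extraction_degree_eq[OF n f xn x True]
      by (simp add: ennreal_of_nat_eq_real_of_nat divide_ennreal)
    finally show ?thesis by (subst (asm) ennreal_inj) auto
  qed
  then have "real (n * k) = real (\<ell> q * f q)" using n by (simp add: field_simps)
  then have "n * k = \<ell> q * f q" by (simp only: of_nat_eq_iff)
  ultimately show ?thesis by simp
next
  case False
  then have "f q = 0" using f by (auto simp: exponents_iff)
  then show ?thesis using cale_map_outside[OF False] by simp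
qed

lemma cale_map_base_prod:
  assumes "f \<in> exponents"
  shows "\<phi> (base_prod f) = (\<lambda>q. \<ell> q * f q)"
  using cale_map_eq[of 1 f "base_prod f"] assms base_prod_closed by (auto simp: fun_eq_iff)

lemma cale_map_mult:
  assumes x: "x \<in> carrier M" and y: "y \<in> carrier M"
  shows "\<phi> (x \<otimes> y) = (\<lambda>q. \<phi> x q + \<phi> y q)"
proof
  fix q
  obtain n f where n: "n > 0" and f: "f \<in> exponents" and xn: "x [^] (n::nat) = base_prod f"
    using power_eq_base_prod[OF x] by blast
  obtain m g where m: "m > 0" and g: "g \<in> exponents" and ym: "y [^] (m::nat) = base_prod g"
    using power_eq_base_prod[OF y] by blast
  have "(x \<otimes> y) [^] (n * m) = (x [^] n) [^] m \<otimes> (y [^] m) [^] n"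
    using x y by (simp add: pow_mult_distrib m_comm nat_pow_pow mult_ac)
  also have "\<dots> = base_prod (\<lambda>q. m * f q + n * g q)"
    by (simp add: base_prod_add exponents_scale f g base_prod_scale xn ym)
  finally have "(n * m) * \<phi> (x \<otimes> y) q = \<ell> q * (m * f q + n * g q)"
    using n m x y by (intro cale_map_eq exponents_add exponents_scale f g) auto
  also have "\<dots> = m * (n * \<phi> x q) + n * (m * \<phi> y q)"
    using cale_map_eq[OF n f xn x, of q] cale_map_eq[OF m g ym y, of q]
    by (simp add: algebra_simps)
  finally have "(n * m) * \<phi> (x \<otimes> y) q = (n * m) * (\<phi> x q + \<phi> y q)"
    by (simp add: algebra_simps)
  then show "\<phi> (x \<otimes> y) q = \<phi> x q + \<phi> y q" using n m by simp
qed

lemma cale_map_one: "\<phi> \<one> = (\<lambda>q. 0)"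
  using cale_map_base_prod[OF exponents_zero] by (simp add: base_prod_zero)

lemma cale_map_exponents:
  assumes x: "x \<in> carrier M"
  shows "\<phi> x \<in> exponents"
proof -
  obtain n f where n: "n > 0" and f: "f \<in> exponents" and xn: "x [^] (n::nat) = base_prod f"
    using power_eq_base_prod[OF x] by blast
  show ?thesis
    by (rule exponents_mono[OF f]) (use cale_map_eq[OF n f xn x] n in \<open>metis mult_is_0 not_gr_zero\<close>)
qed

lemma cale_map_mono: "\<lbrakk>x \<in> carrier M; x divides y\<rbrakk> \<Longrightarrow> \<phi> x q \<le> \<phi> y q"
  by (auto simp: factor_def cale_map_mult)

text \<open>After raising to a common power, both elements are products of base elements, where
  divisibility is comparison of exponents; root-closedness removes the power again.\<close>

lemma divides_of_cale_map_le:
  assumes rc: "root_closed M" and x: "x \<in> carrier M" and y: "y \<in> carrier M"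
    and le: "\<And>q. \<phi> x q \<le> \<phi> y q"
  shows "x divides y"
proof -
  obtain n f where n: "n > 0" and f: "f \<in> exponents" and xn: "x [^] (n::nat) = base_prod f"
    using power_eq_base_prod[OF x] by blast
  obtain m g where m: "m > 0" and g: "g \<in> exponents" and ym: "y [^] (m::nat) = base_prod g"
    using power_eq_base_prod[OF y] by blast
  have "m * f q \<le> n * g q" for q
  proof (cases "q \<in> Q")
    case True
    have "\<ell> q * (m * f q) = m * (n * \<phi> x q)"
      using cale_map_eq[OF n f xn x, of q] by simp
    also have "\<dots> \<le> n * (m * \<phi> y q)" using le[of q] by (simp add: mult_ac)
    also have "\<dots> = \<ell> q * (n * g q)"
      using cale_map_eq[OF m g ym y, of q] by simp
    finally show ?thesis using level_pos[OF True] by simp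
  next
    case False
    then have "f q = 0" using f by (auto simp: exponents_iff)
    then show ?thesis by simp
  qed
  then have "base_prod (\<lambda>q. m * f q) divides base_prod (\<lambda>q. n * g q)"
    by (intro base_prod_mono exponents_scale g)
  then have pow: "(x [^] (n * m)) divides (y [^] (n * m))"
    using x y by (simp add: base_prod_scale f g flip: xn ym) (simp add: nat_pow_pow mult_ac)
  have "n * m > 0" using n m by simp
  then show ?thesis by (rule root_closed_divides[OF rc _ x y pow])
qed

lemma cale_map_inject:
  assumes rc: "root_closed M" and x: "x \<in> carrier M" and y: "y \<in> carrier M" and eq: "\<phi> x = \<phi> y"
  shows "x = y"
proof -
  have "x \<sim> y"
    using divides_of_cale_map_le[OF rc] x y eq by (simp add: associated_def)
  then show ?thesis
    by (rule associatedE2) (use x y reduced in auto)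
qed

section \<open>The Apery set as a set of remainders\<close>

lemma apery_set_iff:
  assumes rc: "root_closed M"
  shows "c \<in> apery_set M Q \<longleftrightarrow> c \<in> carrier M \<and> (\<forall>q\<in>Q. \<phi> c q < \<ell> q)"
proof -
  have "q divides c \<longleftrightarrow> \<ell> q \<le> \<phi> c q" if c: "c \<in> carrier M" and q: "q \<in> Q" for q
  proof -
    have "q = base_prod (single_exponent q 1)" using q by (simp add: base_prod_single base_closed)
    then have phi_q: "\<phi> q = (\<lambda>p. \<ell> p * single_exponent q 1 p)"
      using cale_map_base_prod[OF single_exponents[OF q]] by metis
    then have at: "\<phi> q q = \<ell> q" and off: "\<And>p. p \<noteq> q \<Longrightarrow> \<phi> q p = 0"
      by (auto simp: single_exponent_def)
    show ?thesis
    proof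
      assume "q divides c"
      from cale_map_mono[OF base_closed[OF q] this, of q] show "\<ell> q \<le> \<phi> c q"
        unfolding at .
    next
      assume "\<ell> q \<le> \<phi> c q"
      then have "\<phi> q p \<le> \<phi> c p" for p
        using at off by (cases "p = q") auto
      then show "q divides c"
        using divides_of_cale_map_le[OF rc base_closed[OF q] c] by blast
    qed
  qed
  moreover have "c \<in> apery_set M Q \<longleftrightarrow> c \<in> carrier M \<and> (\<forall>q\<in>Q. \<not> q divides c)"
    unfolding apery_set_def set_mult_def factor_def by auto
  ultimately show ?thesis by (auto simp: not_le)
qed

lemma quotients_exponents:
  assumes "x \<in> carrier M"
  shows "(\<lambda>q. \<phi> x q div \<ell> q) \<in> exponents"
  by (rule exponents_mono[OF cale_map_exponents[OF assms]]) (metis div_0)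

text \<open>The remainders of \<open>\<phi> x\<close> modulo \<open>\<ell>\<close> are again a value of \<open>\<phi>\<close>: the product of base elements
  with the quotients as exponents divides \<open>x\<close>, and its complement has these remainders.\<close>

lemma apery_remainder_exists:
  assumes rc: "root_closed M" and x: "x \<in> carrier M"
  obtains c where "c \<in> apery_set M Q" "\<And>q. \<phi> c q = \<phi> x q mod \<ell> q"
    "x \<in> c <# submonoid_generated M Q"
proof -
  define d where "d = base_prod (\<lambda>q. \<phi> x q div \<ell> q)"
  have d: "d \<in> carrier M" "\<phi> d = (\<lambda>q. \<ell> q * (\<phi> x q div \<ell> q))"
    using cale_map_base_prod quotients_exponents[OF x] by (simp_all add: d_def base_prod_closed)
  have "d divides x"
    using divides_of_cale_map_le[OF rc d(1) x] by (simp add: d(2))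
  then obtain c where c: "c \<in> carrier M" "x = d \<otimes> c" by auto
  have "\<phi> x = (\<lambda>q. \<ell> q * (\<phi> x q div \<ell> q) + \<phi> c q)"
    using cale_map_mult[OF d(1) c(1)] unfolding c(2)[symmetric] d(2) .
  then have "\<phi> x q = \<ell> q * (\<phi> x q div \<ell> q) + \<phi> c q" for q
    by (rule fun_cong)
  then have rem: "\<phi> c q = \<phi> x q mod \<ell> q" for q
    by (metis add_left_cancel mult_div_mod_eq)
  show ?thesis
  proof
    show "c \<in> apery_set M Q"
      using c(1) level_pos by (simp add: apery_set_iff[OF rc] rem)
    have "d \<in> submonoid_generated M Q"
      unfolding submonoid_generated_eq d_def using quotients_exponents[OF x] by blast
    then show "x \<in> c <# submonoid_generated M Q"
      using c d(1) by (auto simp: l_coset_def m_comm)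
  qed (rule rem)
qed

lemma apery_determined:
  assumes rc: "root_closed M" and c: "c \<in> apery_set M Q" and d: "d \<in> apery_set M Q"
    and eq: "\<And>q. \<phi> c q mod \<ell> q = \<phi> d q mod \<ell> q"
  shows "c = d"
proof (rule cale_map_inject[OF rc])
  show "\<phi> c = \<phi> d"
  proof
    fix q show "\<phi> c q = \<phi> d q"
      using c d eq[of q] by (cases "q \<in> Q") (auto simp: apery_set_iff[OF rc] cale_map_outside)
  qed
qed (use c d in \<open>auto simp: apery_set_iff[OF rc]\<close>)

lemma cale_map_mod_coset:
  assumes c: "c \<in> carrier M" and x: "x \<in> c <# submonoid_generated M Q"
  shows "\<phi> x q mod \<ell> q = \<phi> c q mod \<ell> q"
proof -
  obtain f where "f \<in> exponents" "x = c \<otimes> base_prod f"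
    using x by (auto simp: l_coset_def submonoid_generated_eq)
  then show ?thesis using c by (simp add: cale_map_mult base_prod_closed cale_map_base_prod)
qed

lemma apery_mult:
  assumes rc: "root_closed M" and a: "a \<in> apery_set M Q" and b: "b \<in> apery_set M Q"
  shows "a \<otimes>\<^bsub>apery_monoid M Q\<^esub> b \<in> apery_set M Q"
    and "\<phi> (a \<otimes>\<^bsub>apery_monoid M Q\<^esub> b) q = (\<phi> a q + \<phi> b q) mod \<ell> q"
proof -
  have ab: "a \<in> carrier M" "b \<in> carrier M" using a b by (simp_all add: apery_set_iff[OF rc])
  then obtain c where c: "c \<in> apery_set M Q" "\<And>q. \<phi> c q = \<phi> (a \<otimes> b) q mod \<ell> q"
    "a \<otimes> b \<in> c <# submonoid_generated M Q"
    using apery_remainder_exists[OF rc, of "a \<otimes> b"] by blast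
  have unique: "d = c"
    if d: "d \<in> apery_set M Q" "a \<otimes> b \<in> d <# submonoid_generated M Q" for d
  proof (rule apery_determined[OF rc d(1) c(1)])
    have "d \<in> carrier M" using d(1) by (simp add: apery_set_iff[OF rc])
    from cale_map_mod_coset[OF this d(2)] show "\<phi> d q mod \<ell> q = \<phi> c q mod \<ell> q" for q
      by (simp add: c(2))
  qed
  have "(THE c. c \<in> apery_set M Q \<and> a \<otimes> b \<in> c <# submonoid_generated M Q) = c"
    using c(1,3) unique by (intro the_equality conjI) (assumption | erule conjE | rule unique)+
  then have "a \<otimes>\<^bsub>apery_monoid M Q\<^esub> b = c"
    by (simp add: apery_monoid_def)
  then show "a \<otimes>\<^bsub>apery_monoid M Q\<^esub> b \<in> apery_set M Q"
    and "\<phi> (a \<otimes>\<^bsub>apery_monoid M Q\<^esub> b) q = (\<phi> a q + \<phi> b q) mod \<ell> q"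
    using c ab by (simp_all add: cale_map_mult)
qed

section \<open>The inner class group as a group of remainders\<close>

abbreviation cale_image ("\<S>") where
  "\<S> \<equiv> (finsupp_monoid Q)\<lparr>carrier := \<phi> ` carrier M\<rparr>"

lemma cale_image_mult:
  "f \<otimes>\<^bsub>\<S>\<^esub> g = (\<lambda>q. f q + g q)" "f \<otimes>\<^bsub>finsupp_monoid Q\<^esub> g = (\<lambda>q. f q + g q)"
  by (simp_all add: finsupp_monoid_def)

lemma cale_image_one: "\<one>\<^bsub>\<S>\<^esub> = (\<lambda>q. 0)" "\<one>\<^bsub>finsupp_monoid Q\<^esub> = (\<lambda>q. 0)"
  by (simp_all add: finsupp_monoid_def)

lemma cale_image_comm_monoid_cancel: "comm_monoid_cancel \<S>"
proof (rule comm_monoid_cancelI)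
  show "comm_monoid \<S>"
  proof (rule comm_monoidI)
    fix f g assume "f \<in> carrier \<S>" "g \<in> carrier \<S>"
    then obtain x y where "x \<in> carrier M" "y \<in> carrier M" "f = \<phi> x" "g = \<phi> y" by auto
    then have "f \<otimes>\<^bsub>\<S>\<^esub> g = \<phi> (x \<otimes> y)" "x \<otimes> y \<in> carrier M"
      by (simp_all add: cale_image_mult cale_map_mult)
    then show "f \<otimes>\<^bsub>\<S>\<^esub> g \<in> carrier \<S>" by simp
  next
    show "\<one>\<^bsub>\<S>\<^esub> \<in> carrier \<S>"
      unfolding cale_image_one cale_map_one[symmetric] by simp
  qed (auto simp: cale_image_mult cale_image_one add_ac)
qed (simp add: cale_image_mult fun_eq_iff)

lemma cale_image_submonoid: "submonoid (\<phi> ` submonoid_generated M Q) \<S>"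
proof -
  interpret F: submonoid "submonoid_generated M Q" M by (rule submonoid_generated_submonoid)
  show ?thesis
  proof
    fix f g assume "f \<in> \<phi> ` submonoid_generated M Q" "g \<in> \<phi> ` submonoid_generated M Q"
    then obtain x y where xy: "x \<in> submonoid_generated M Q" "y \<in> submonoid_generated M Q"
      "f = \<phi> x" "g = \<phi> y" by auto
    then have "f \<otimes>\<^bsub>\<S>\<^esub> g = \<phi> (x \<otimes> y)"
      using F.subset by (auto simp: cale_image_mult cale_map_mult)
    then show "f \<otimes>\<^bsub>\<S>\<^esub> g \<in> \<phi> ` submonoid_generated M Q" using xy by simp
  next
    show "\<one>\<^bsub>\<S>\<^esub> \<in> \<phi> ` submonoid_generated M Q"
      unfolding cale_image_one cale_map_one[symmetric] by simp
  qed (use F.subset in auto)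
qed

abbreviation cale_congruence ("\<R>") where
  "\<R> \<equiv> submonoid_congruence \<S> (\<phi> ` submonoid_generated M Q)"

lemma cale_congruence_iff:
  "(s, s') \<in> \<R> \<longleftrightarrow>
    s \<in> \<phi> ` carrier M \<and> s' \<in> \<phi> ` carrier M \<and> (\<forall>q. s q mod \<ell> q = s' q mod \<ell> q)"
proof -
  have "(\<exists>t\<in>\<phi> ` submonoid_generated M Q. \<exists>t'\<in>\<phi> ` submonoid_generated M Q.
      s' \<otimes>\<^bsub>\<S>\<^esub> t' = t \<otimes>\<^bsub>\<S>\<^esub> s) \<longleftrightarrow> (\<forall>q. s q mod \<ell> q = s' q mod \<ell> q)" (is "?L \<longleftrightarrow> ?R")
    if s: "s \<in> \<phi> ` carrier M" "s' \<in> \<phi> ` carrier M"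
  proof
    assume ?L
    then obtain f g where fg: "f \<in> exponents" "g \<in> exponents"
      and "s' \<otimes>\<^bsub>\<S>\<^esub> \<phi> (base_prod g) = \<phi> (base_prod f) \<otimes>\<^bsub>\<S>\<^esub> s"
      by (auto simp: submonoid_generated_eq)
    then have "s' q + \<ell> q * g q = \<ell> q * f q + s q" for q
      by (simp add: cale_image_mult cale_map_base_prod fun_eq_iff)
    then show ?R by (metis mod_mult_self2 mod_mult_self4)
  next
    assume R: ?R
    \<comment> \<open>Both functions are completed to \<open>r + \<ell> (k + k')\<close>, where \<open>r\<close> is the common remainder and
      \<open>k\<close>, \<open>k'\<close> are the quotients.\<close>
    let ?k = "\<lambda>q. s q div \<ell> q" and ?k' = "\<lambda>q. s' q div \<ell> q"
    have k: "?k \<in> exponents" "?k' \<in> exponents" using s quotients_exponents by auto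
    have "s' q + \<ell> q * ?k q = \<ell> q * ?k' q + s q" for q
      using R mult_div_mod_eq[of "\<ell> q" "s q"] mult_div_mod_eq[of "\<ell> q" "s' q"]
      by (metis add.commute add.left_commute)
    then have "s' \<otimes>\<^bsub>\<S>\<^esub> \<phi> (base_prod ?k) = \<phi> (base_prod ?k') \<otimes>\<^bsub>\<S>\<^esub> s"
      using k by (simp add: cale_image_mult cale_map_base_prod)
    then show ?L using k unfolding submonoid_generated_eq by blast
  qed
  then show ?thesis
    unfolding comm_monoid_cancel.submonoid_congruence_iff[OF cale_image_comm_monoid_cancel
        cale_image_submonoid]
    by auto
qed

lemma cale_monoid_congruence: "monoid_congruence \<S> \<R>"
proof -
  interpret S: comm_monoid_cancel \<S> by (rule cale_image_comm_monoid_cancel)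
  show ?thesis
  proof
    show "equiv (carrier \<S>) \<R>"
      by (rule equivI) (auto simp: cale_congruence_iff refl_on_def sym_def trans_def)
    show "(a \<otimes>\<^bsub>\<S>\<^esub> b, a' \<otimes>\<^bsub>\<S>\<^esub> b') \<in> \<R>"
      if "(a, a') \<in> \<R>" "(b, b') \<in> \<R>" for a a' b b'
    proof -
      have "a \<otimes>\<^bsub>\<S>\<^esub> b \<in> \<phi> ` carrier M" "a' \<otimes>\<^bsub>\<S>\<^esub> b' \<in> \<phi> ` carrier M"
        using that S.m_closed by (simp_all add: cale_congruence_iff)
      moreover have "(a q + b q) mod \<ell> q = (a' q + b' q) mod \<ell> q" for q
        using that by (intro mod_add_cong) (auto simp: cale_congruence_iff)
      ultimately show ?thesis by (simp add: cale_congruence_iff cale_image_mult)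
    qed
  qed
qed

lemma inner_class_group_eq: "inner_class_group M Q = quotient_monoid \<S> \<R>"
  by (simp add: inner_class_group_def quotient_by_submonoid_def)

text \<open>It is easier to map the Apery set to the classes than conversely, because a class does not
  come with a representative in the Apery set.\<close>

lemma apery_to_class_iso:
  assumes rc: "root_closed M"
  shows "(\<lambda>c. \<R> `` {\<phi> c}) \<in> iso (apery_monoid M Q) (inner_class_group M Q)"
proof -
  interpret R: monoid_congruence \<S> \<R> by (rule cale_monoid_congruence)
  have A: "carrier (apery_monoid M Q) = apery_set M Q" by (simp add: apery_monoid_def)
  have carr: "c \<in> carrier M" if "c \<in> apery_set M Q" for c
    using that by (simp add: apery_set_iff[OF rc])
  have hom: "\<R> `` {\<phi> (a \<otimes>\<^bsub>apery_monoid M Q\<^esub> b)} =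
      \<R> `` {\<phi> a} \<otimes>\<^bsub>inner_class_group M Q\<^esub> \<R> `` {\<phi> b}"
    if ab: "a \<in> apery_set M Q" "b \<in> apery_set M Q" for a b
  proof -
    have "(\<phi> (a \<otimes>\<^bsub>apery_monoid M Q\<^esub> b), \<phi> a \<otimes>\<^bsub>\<S>\<^esub> \<phi> b) \<in> \<R>"
      using apery_mult[OF rc ab] R.m_closed[of "\<phi> a" "\<phi> b"] ab carr
      by (simp add: cale_congruence_iff cale_image_mult)
    then have "\<R> `` {\<phi> (a \<otimes>\<^bsub>apery_monoid M Q\<^esub> b)} = \<R> `` {\<phi> a \<otimes>\<^bsub>\<S>\<^esub> \<phi> b}"
      by (rule equiv_class_eq[OF R.equiv])
    then show ?thesis
      using ab carr by (simp add: inner_class_group_eq R.mult_quotient)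
  qed
  have "inj_on (\<lambda>c. \<R> `` {\<phi> c}) (apery_set M Q)"
  proof (rule inj_onI)
    fix c d assume cd: "c \<in> apery_set M Q" "d \<in> apery_set M Q" and "\<R> `` {\<phi> c} = \<R> `` {\<phi> d}"
    then have "(\<phi> c, \<phi> d) \<in> \<R>" using carr by (simp add: R.class_eq_iff)
    then show "c = d"
      using cd by (intro apery_determined[OF rc]) (auto simp: cale_congruence_iff)
  qed
  moreover have "(\<lambda>c. \<R> `` {\<phi> c}) ` apery_set M Q = carrier (inner_class_group M Q)"
  proof
    show "(\<lambda>c. \<R> `` {\<phi> c}) ` apery_set M Q \<subseteq> carrier (inner_class_group M Q)"
      using carr by (auto simp: inner_class_group_eq R.carrier_quotient)
    show "carrier (inner_class_group M Q) \<subseteq> (\<lambda>c. \<R> `` {\<phi> c}) ` apery_set M Q"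
    proof
      fix X assume "X \<in> carrier (inner_class_group M Q)"
      then obtain x where x: "x \<in> carrier M" "X = \<R> `` {\<phi> x}"
        by (auto simp: inner_class_group_eq R.carrier_quotient)
      obtain c where c: "c \<in> apery_set M Q" "\<And>q. \<phi> c q = \<phi> x q mod \<ell> q"
        using apery_remainder_exists[OF rc x(1)] by blast
      have "(\<phi> c, \<phi> x) \<in> \<R>" using c x(1) carr by (simp add: cale_congruence_iff)
      then have "\<R> `` {\<phi> c} = X" using equiv_class_eq[OF R.equiv] x(2) by blast
      then show "X \<in> (\<lambda>c. \<R> `` {\<phi> c}) ` apery_set M Q" using c(1) by blast
    qed
  qed
  ultimately show ?thesis
    using hom by (auto simp: iso_def hom_def bij_betw_def A)
qed

end

text \<open>Closure of the source under multiplication makes the product of two preimages the preimage of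
  the product.\<close>

lemma inv_into_iso:
  assumes h: "h \<in> iso H K"
    and closed: "\<And>a b. \<lbrakk>a \<in> carrier H; b \<in> carrier H\<rbrakk> \<Longrightarrow> a \<otimes>\<^bsub>H\<^esub> b \<in> carrier H"
  shows "inv_into (carrier H) h \<in> iso K H"
proof -
  let ?g = "inv_into (carrier H) h"
  have bij: "bij_betw h (carrier H) (carrier K)" and hom: "h \<in> hom H K"
    using h by (auto simp: iso_def)
  have g: "?g x \<in> carrier H" "h (?g x) = x" if "x \<in> carrier K" for x
    using that bij by (auto simp: bij_betw_def inv_into_into f_inv_into_f)
  have "?g (x \<otimes>\<^bsub>K\<^esub> y) = ?g x \<otimes>\<^bsub>H\<^esub> ?g y" if "x \<in> carrier K" "y \<in> carrier K" for x y
  proof -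
    have "h (?g x \<otimes>\<^bsub>H\<^esub> ?g y) = x \<otimes>\<^bsub>K\<^esub> y"
      using hom_mult[OF hom] g that by simp
    then show ?thesis
      using inv_into_f_f[OF bij_betw_imp_inj_on[OF bij] closed[OF g(1) g(1)]] that by metis
  qed
  then show ?thesis
    using bij_betw_inv_into[OF bij] g(1) by (auto simp: iso_def hom_def)
qed

theorem corollary5:
  fixes M :: "('a, 'b) monoid_scheme" and Q :: "'a set"
  assumes "reduced_monoid M" and "root_closed M" and "cale_monoid M Q"
  shows "inner_class_group M Q \<cong> apery_monoid M Q"
proof -
  interpret cale_monoid M Q by fact
  have "inv_into (carrier (apery_monoid M Q)) (\<lambda>c. \<R> `` {\<phi> c})
      \<in> iso (inner_class_group M Q) (apery_monoid M Q)"
    using apery_mult(1)[OF \<open>root_closed M\<close>]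
    by (intro inv_into_iso apery_to_class_iso \<open>root_closed M\<close>) (simp add: apery_monoid_def)
  then show ?thesis unfolding is_iso_def by blast
qed

end
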